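(* Let $|z|<1$, $|q|<1$, and let $(b_k)_{k\ge1}$ be a sequence of complex numbers. Let $$Q(q)=\prod_{k=1}^\infty\frac{1}{(1-zq^k)^{b_k}}=\sum_{n\ge0}P(n)q^n,$$ so that $$P(n)=\sum_{\pi=\sum r_iu_i,\ |\pi|=n}\ \prod_i\frac{(b_i)_{r_i}}{r_i!}z^{r_i},$$ the sum over all partitions $\pi$ of $n$, and define $$F_k(n)=\sum_{\pi=\sum r_iu_i,\ |\pi|=n,\ r_k>0} r_k\prod_i\frac{(b_i)_{r_i}}{r_i!}z^{r_i},$$ the sum over all partitions of $n$ containing $k$ as a part. Then: (a) $P(0)=1$; (b) for every $n\ge1$ and every $i=1,\dots,n$, $$F_i(n)=\sum_{j=1}^n a_i(j)P(n-j),\qquad a_i(j)=\begin{cases}b_iz^r,& j=ri \text{ for some integer } r\ge1,\\ 0,&\text{otherwise};\end{cases}$$ equivalently $iF_i(n)=\sum_{j=1}^n i\,a_i(j)P(n-j)$; (c) for every $n\ge1$, $\sum_{k=1}^n kF_k(n)=nP(n)$.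
   Context: A partition $\pi$ of $n$ is written $\pi=\sum_i r_iu_i$, meaning the part $i$ occurs $r_i\ge0$ times, with $\sum_i ir_i=n$ (written $|\pi|=n$). $(a)_0=1$ and $(a)_r=a(a+1)\cdots(a+r-1)$ for $r>0$.
   Formalization: For arbitrary b_k the product may diverge for q≠0 (e.g. b_k=k!, z=1/2), so Q and P(n) are taken as formal power series in q; the numerical identity Q(q)=ΣP(n)q^n is asserted when Σ|b_k z q^k| converges. The partition formula and (a)–(c) hold for all b. *)

theory Defs
  imports "HOL-Analysis.Analysis"
begin

text \<open>
  A partition \<open>\<pi> = \<Sum>\<^sub>i r\<^sub>i u\<^sub>i\<close> of \<open>n\<close> is represented by its multiplicity function \<open>r\<close>, extended
  by \<open>0\<close> to the indices that cannot be parts. The bound \<open>i \<le> n\<close> on the support loses nothing,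
  as every part of a partition of \<open>n\<close> is at most \<open>n\<close>.
\<close>

definition partitions :: "nat \<Rightarrow> (nat \<Rightarrow> nat) set" where
  "partitions n = {r. (\<forall>i. r i \<noteq> 0 \<longrightarrow> 1 \<le> i \<and> i \<le> n) \<and> (\<Sum>i=1..n. i * r i) = n}"

lemma finite_partitions: "finite (partitions n)"
proof (rule finite_subset)
  show "partitions n \<subseteq> {r. \<forall>i. (i \<in> {1..n} \<longrightarrow> r i \<in> {..n}) \<and> (i \<notin> {1..n} \<longrightarrow> r i = 0)}"
  proof (clarsimp simp: partitions_def, intro conjI allI impI)
    fix r :: "nat \<Rightarrow> nat" and i
    assume s: "(\<Sum>i=Suc 0..n. i * r i) = n"
    assume i: "Suc 0 \<le> i \<and> i \<le> n"
    have "r i \<le> i * r i"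
      using i by (cases i) auto
    also have "i * r i \<le> (\<Sum>i=Suc 0..n. i * r i)"
      using i by (intro member_le_sum) auto
    finally show "r i \<le> n"
      using s by simp
  qed auto
  show "finite {r. \<forall>i. (i \<in> {1..n} \<longrightarrow> r i \<in> {..n}) \<and> (i \<notin> {1..n} \<longrightarrow> r i = (0::nat))}"
    by (rule finite_set_of_finite_funs) auto
qed

text \<open>
  Indices \<open>i > n\<close> are left out of the product: there \<open>r i = 0\<close> and the factor is \<open>1\<close>.
\<close>

definition weight :: "(nat \<Rightarrow> complex) \<Rightarrow> complex \<Rightarrow> nat \<Rightarrow> (nat \<Rightarrow> nat) \<Rightarrow> complex" where
  "weight b z n r = (\<Prod>i=1..n. pochhammer (b i) (r i) / fact (r i) * z ^ r i)"

text \<open>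
  For arbitrary \<open>b\<close> the infinite product defining \<open>Q\<close> need not converge at any \<open>q \<noteq> 0\<close>, so \<open>Q\<close> is
  taken as a formal power series in \<open>q\<close>. Here \<open>fps_binomial c\<close> is the series of \<open>(1 + X)\<^sup>c\<close>, and the
  infinite product refers to the usual topology of formal power series (coefficients become
  stationary). The sequence \<open>b\<close> is indexed from \<open>1\<close>; the value \<open>b 0\<close> is never used.
\<close>

definition Q_factor :: "(nat \<Rightarrow> complex) \<Rightarrow> complex \<Rightarrow> nat \<Rightarrow> complex fps" where
  "Q_factor b z k = inverse (fps_binomial (b k) oo (- (fps_const z * fps_X ^ k)))"

definition Q :: "(nat \<Rightarrow> complex) \<Rightarrow> complex \<Rightarrow> complex fps" where
  "Q b z = prodinf (\<lambda>k. Q_factor b z (Suc k))"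

definition P :: "(nat \<Rightarrow> complex) \<Rightarrow> complex \<Rightarrow> nat \<Rightarrow> complex" where
  "P b z n = fps_nth (Q b z) n"

definition F :: "(nat \<Rightarrow> complex) \<Rightarrow> complex \<Rightarrow> nat \<Rightarrow> nat \<Rightarrow> complex" where
  "F b z k n = (\<Sum>r \<in> {r \<in> partitions n. r k > 0}. of_nat (r k) * weight b z n r)"

text \<open>
  For \<open>i \<ge> 1\<close>, the exponent \<open>r\<close> with \<open>j = r * i\<close> is \<open>j div i\<close>.
\<close>

definition a :: "(nat \<Rightarrow> complex) \<Rightarrow> complex \<Rightarrow> nat \<Rightarrow> nat \<Rightarrow> complex" where
  "a b z i j = (if \<exists>r\<ge>1. j = r * i then b i * z ^ (j div i) else 0)"

end

theory Submission
  imports Defs "HOL-Computational_Algebra.Formal_Laurent_Series"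
begin

text \<open>
  The factor of index \<open>k\<close> is \<open>\<Sum>m. (b k)\<^sub>m / m! z ^ m q ^ (k m)\<close>, so expanding the product gives the sum
  over partitions. Weighting each partition by \<open>r k\<close> replaces this single factor by its image under
  \<open>x d/dx\<close>, where \<open>x = z q ^ k\<close>, and
  \<open>x d/dx (1 - x) powr (- b k) = (b k x + b k x ^ 2 + \<dots>) (1 - x) powr (- b k)\<close>; comparing
  coefficients gives the recurrence. Summing \<open>k r k\<close> over \<open>k\<close> inside the sum over partitions gives
  the last identity. Analytic convergence follows by Tannery's theorem, with the product of the
  factors with absolute values as coefficients as majorant.
\<close>

section \<open>Infinite products of formal power series\<close>

lemma fps_mult_nth_eq_left:
  fixes f g :: "'a::comm_ring_1 fps"
  assumes "fps_nth g 0 = 1" and "\<And>j. 0 < j \<Longrightarrow> j \<le> n \<Longrightarrow> fps_nth g j = 0"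
  shows "fps_nth (f * g) n = fps_nth f n"
proof -
  have "fps_nth (f * g) n = (\<Sum>i\<in>{0..n}. if i = n then fps_nth f n else 0)"
    unfolding fps_mult_nth by (rule sum.cong) (use assms in auto)
  then show ?thesis
    by simp
qed

text \<open>The factor of index \<open>k\<close> is 1 plus terms of degree above \<open>k\<close>,
  so multiplying by factors of index at least \<open>n\<close> cannot change the coefficient of
  degree \<open>n\<close>.\<close>

lemma fps_prod_nth_stable:
  fixes f :: "nat \<Rightarrow> 'a::comm_ring_1 fps"
  assumes "\<And>k. fps_nth (f k) 0 = 1" and "\<And>k j. 0 < j \<Longrightarrow> j \<le> k \<Longrightarrow> fps_nth (f k) j = 0"
    and "n \<le> N"
  shows "fps_nth (\<Prod>k<N. f k) n = fps_nth (\<Prod>k<n. f k) n"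
  using \<open>n \<le> N\<close>
proof (induction rule: dec_induct)
  case (step N)
  have "fps_nth ((\<Prod>k<N. f k) * f N) n = fps_nth (\<Prod>k<N. f k) n"
    by (rule fps_mult_nth_eq_left) (use assms step in auto)
  then show ?case
    using step by simp
qed simp

text \<open>The coefficient of degree \<open>n\<close> is frozen after \<open>n\<close> factors, so
  the limit is read off along the diagonal.\<close>

lemma fps_has_prod:
  fixes f :: "nat \<Rightarrow> 'a::idom fps"
  assumes "\<And>k. fps_nth (f k) 0 = 1" and "\<And>k j. 0 < j \<Longrightarrow> j \<le> k \<Longrightarrow> fps_nth (f k) j = 0"
  shows "f has_prod Abs_fps (\<lambda>n. fps_nth (\<Prod>k<n. f k) n)" (is "_ has_prod ?L")
proof -
  have "(\<lambda>n. \<Prod>i\<le>n. f i) \<longlonglongrightarrow> ?L"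
  proof (rule tendsto_fpsI)
    fix n
    have "fps_nth (\<Prod>i\<le>N. f i) n = fps_nth ?L n" if "N \<ge> n" for N
      using fps_prod_nth_stable[of f n "Suc N"] that assms
      by (simp add: lessThan_Suc_atMost)
    then show "\<forall>\<^sub>F N in sequentially. fps_nth (\<Prod>i\<le>N. f i) n = fps_nth ?L n"
      by (auto simp: eventually_sequentially)
  qed
  \<comment> \<open>\<open>has_prod\<close> demands a nonzero limit; the constant coefficient 1
    provides this.\<close>
  moreover have "fps_nth ?L 0 = 1"
    by simp
  then have "?L \<noteq> 0"
    by (metis fps_zero_nth zero_neq_one)
  ultimately show ?thesis
    by (auto simp: has_prod_def raw_has_prod_def)
qed

section \<open>Evaluating products of power series at a point\<close>

text \<open>The terms of \<open>f * g\<close> at \<open>x\<close> are the Cauchy product of the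
  terms of \<open>f\<close> and of \<open>g\<close>, and absolutely convergent series may be
  multiplied in this way.\<close>

lemma fps_mult_eval:
  fixes f g :: "'a::{real_normed_field, banach} fps"
  assumes f: "summable (\<lambda>n. norm (fps_nth f n * x ^ n))"
    and g: "summable (\<lambda>n. norm (fps_nth g n * x ^ n))"
  shows "summable (\<lambda>n. norm (fps_nth (f * g) n * x ^ n))"
    and "(\<Sum>n. fps_nth (f * g) n * x ^ n) =
           (\<Sum>n. fps_nth f n * x ^ n) * (\<Sum>n. fps_nth g n * x ^ n)"
proof -
  have eq: "fps_nth (f * g) n * x ^ n =
      (\<Sum>i\<le>n. (fps_nth f i * x ^ i) * (fps_nth g (n - i) * x ^ (n - i)))" for n
  proof -
    have "(fps_nth f i * x ^ i) * (fps_nth g (n - i) * x ^ (n - i)) =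
        fps_nth f i * fps_nth g (n - i) * x ^ n" if "i \<le> n" for i
    proof -
      have "x ^ n = x ^ i * x ^ (n - i)"
        using that by (simp flip: power_add)
      then show ?thesis
        by (simp add: ac_simps)
    qed
    note coeff = this
    show ?thesis
      unfolding fps_mult_nth sum_distrib_right atMost_atLeast0
      by (intro sum.cong refl coeff[symmetric]) simp
  qed
  have "summable (\<lambda>n. \<Sum>i\<le>n. norm (fps_nth f i * x ^ i) * norm (fps_nth g (n - i) * x ^ (n - i)))"
    by (rule summable_Cauchy_product) (use f g in simp_all)
  then show "summable (\<lambda>n. norm (fps_nth (f * g) n * x ^ n))"
  proof (rule summable_comparison_test'[where N = 0])
    fix n
    show "norm (norm (fps_nth (f * g) n * x ^ n)) \<le>
        (\<Sum>i\<le>n. norm (fps_nth f i * x ^ i) * norm (fps_nth g (n - i) * x ^ (n - i)))"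
      unfolding eq real_norm_def abs_norm_cancel by (rule sum_norm_le) (simp add: norm_mult)
  qed
  show "(\<Sum>n. fps_nth (f * g) n * x ^ n) =
      (\<Sum>n. fps_nth f n * x ^ n) * (\<Sum>n. fps_nth g n * x ^ n)"
    unfolding eq by (rule Cauchy_product[OF f g, symmetric])
qed

lemma fps_prod_eval:
  fixes f :: "nat \<Rightarrow> 'a::{real_normed_field, banach} fps"
  assumes "\<And>k. summable (\<lambda>n. norm (fps_nth (f k) n * x ^ n))"
  shows "summable (\<lambda>n. norm (fps_nth (\<Prod>k<N. f k) n * x ^ n)) \<and>
         (\<Sum>n. fps_nth (\<Prod>k<N. f k) n * x ^ n) = (\<Prod>k<N. \<Sum>n. fps_nth (f k) n * x ^ n)"
proof (induction N)
  case 0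
  have *: "fps_nth (1::'a fps) n * x ^ n = (if n = 0 then 1 else 0)" for n
    by simp
  show ?case
    unfolding prod.lessThan_Suc lessThan_0 prod.empty *
    using sums_single[of 0 "\<lambda>_. 1::'a"] sums_single[of 0 "\<lambda>_. 1::real"]
    by (simp add: sums_iff if_distrib[of norm] cong: if_cong)
next
  case (Suc N)
  then show ?case
    using fps_mult_eval[of "\<Prod>k<N. f k" x "f N"] assms by simp
qed

text \<open>The triangle inequality, applied to one Cauchy product after another. The right-hand
  side is the majorant for dominated convergence.\<close>

lemma fps_prod_nth_norm_le:
  fixes f :: "nat \<Rightarrow> 'a::real_normed_field fps"
  shows "norm (fps_nth (\<Prod>k<N. f k) n) \<le> fps_nth (\<Prod>k<N. Abs_fps (\<lambda>n. norm (fps_nth (f k) n))) n"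
proof (induction N arbitrary: n)
  case (Suc N)
  show ?case
    by (auto simp: fps_mult_nth norm_mult intro!: sum_norm_le mult_right_mono Suc)
qed simp

text \<open>The coefficients of the finite products are dominated by those of the infinite product
  of the series \<open>D k\<close> of absolute values. The uniform bound \<open>K\<close> on the
  finite products of the \<open>D k\<close> at \<open>norm x\<close> makes this majorant summable,
  so the limit over the number of factors may be taken termwise.\<close>

lemma fps_infinite_prod_eval:
  fixes f :: "nat \<Rightarrow> 'a::{real_normed_field, banach} fps"
  assumes f0: "\<And>k. fps_nth (f k) 0 = 1"
    and fz: "\<And>k j. 0 < j \<Longrightarrow> j \<le> k \<Longrightarrow> fps_nth (f k) j = 0"
    and summ: "\<And>k. summable (\<lambda>n. norm (fps_nth (f k) n * x ^ n))"
    and bound: "\<And>N. (\<Prod>k<N. \<Sum>n. norm (fps_nth (f k) n * x ^ n)) \<le> K"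
  shows "summable (\<lambda>n. norm (fps_nth (\<Prod>k<n. f k) n * x ^ n))"
    and "(\<lambda>N. \<Prod>k<N. \<Sum>n. fps_nth (f k) n * x ^ n) \<longlonglongrightarrow> (\<Sum>n. fps_nth (\<Prod>k<n. f k) n * x ^ n)"
proof -
  define D where "D k = Abs_fps (\<lambda>n. norm (fps_nth (f k) n))" for k
  define M where "M n = fps_nth (\<Prod>k<n. D k) n * norm x ^ n" for n
  have D0: "fps_nth (D k) 0 = 1" and Dz: "0 < j \<Longrightarrow> j \<le> k \<Longrightarrow> fps_nth (D k) j = 0" for k j
    by (auto simp: D_def f0 fz)
  have Dsumm: "summable (\<lambda>n. norm (fps_nth (D k) n * norm x ^ n))" for k
    using summ[of k] by (simp add: D_def norm_mult norm_power)
  have le: "norm (fps_nth (\<Prod>k<N. f k) n) \<le> fps_nth (\<Prod>k<N. D k) n" for N n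
    unfolding D_def by (rule fps_prod_nth_norm_le)
  then have nonneg: "0 \<le> fps_nth (\<Prod>k<N. D k) n" for N n
    by (meson norm_ge_zero order_trans)
  have D_nonneg: "0 \<le> fps_nth (D k) n" for k n
    by (simp add: D_def)
  have mono: "fps_nth (\<Prod>k<N. D k) n \<le> fps_nth (\<Prod>k<n. D k) n" for N n
  proof (cases "n \<le> N")
    case True
    then show ?thesis
      using fps_prod_nth_stable[of D n N] D0 Dz by simp
  next
    case False
    \<comment> \<open>For \<open>N < n\<close> the coefficient need not be stable yet, but it can
      only grow: all terms of the Cauchy product are nonnegative, and the one with
      \<open>i = n\<close> is the old coefficient because \<open>D m\<close> has constant
      coefficient 1.\<close>
    have "incseq (\<lambda>m. fps_nth (\<Prod>k<m. D k) n)"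
    proof (rule incseq_SucI)
      fix m
      have "fps_nth (\<Prod>k<m. D k) n * fps_nth (D m) (n - n) \<le>
          (\<Sum>i\<in>{0..n}. fps_nth (\<Prod>k<m. D k) i * fps_nth (D m) (n - i))"
        by (rule member_le_sum) (auto intro!: mult_nonneg_nonneg nonneg simp: D_nonneg)
      then show "fps_nth (\<Prod>k<m. D k) n \<le> fps_nth (\<Prod>k<Suc m. D k) n"
        by (simp add: fps_mult_nth D0)
    qed
    then show ?thesis
      using False by (intro incseqD[of "\<lambda>m. fps_nth (\<Prod>k<m. D k) n"]) auto
  qed
  have M_nonneg: "0 \<le> M n" for n
    by (simp add: M_def nonneg)
  have "(\<Sum>n<m. M n) \<le> K" for m
  proof -
    \<comment> \<open>All degrees below \<open>m\<close> are stable after \<open>m\<close> factors,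
      so this partial sum belongs to a single finite product, which can be evaluated factor by
      factor.\<close>
    have "(\<Sum>n<m. M n) = (\<Sum>n<m. fps_nth (\<Prod>k<m. D k) n * norm x ^ n)"
      unfolding M_def
      by (intro sum.cong refl, subst fps_prod_nth_stable[of D _ m, symmetric]) (auto simp: D0 Dz)
    also have "\<dots> \<le> (\<Sum>n. fps_nth (\<Prod>k<m. D k) n * norm x ^ n)"
      by (rule sum_le_suminf)
        (use fps_prod_eval[of D "norm x" m, OF Dsumm] in \<open>auto simp: nonneg intro: summable_norm_cancel\<close>)
    also have "\<dots> = (\<Prod>k<m. \<Sum>n. fps_nth (D k) n * norm x ^ n)"
      using fps_prod_eval[of D "norm x" m, OF Dsumm] by simp
    also have "\<dots> \<le> K"
      using bound[of m] by (simp add: D_def norm_mult norm_power)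
    finally show ?thesis .
  qed
  then have "summable M"
    by (rule summableI_nonneg_bounded[OF M_nonneg])
  moreover have "norm (fps_nth (\<Prod>k<N. f k) n * x ^ n) \<le> M n" for N n
  proof -
    have "norm (fps_nth (\<Prod>k<N. f k) n) \<le> fps_nth (\<Prod>k<n. D k) n"
      using le mono by (rule order_trans)
    then show ?thesis
      by (simp add: M_def norm_mult norm_power mult_right_mono)
  qed
  moreover have "(\<lambda>N. fps_nth (\<Prod>k<N. f k) n * x ^ n) \<longlonglongrightarrow> fps_nth (\<Prod>k<n. f k) n * x ^ n" for n
    by (rule tendsto_eventually, rule eventually_sequentiallyI[of n])
      (subst fps_prod_nth_stable[of f n], use f0 fz in auto)
  ultimately have *: "summable (\<lambda>n. norm (fps_nth (\<Prod>k<n. f k) n * x ^ n)) \<and>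
      (\<lambda>N. \<Sum>n. fps_nth (\<Prod>k<N. f k) n * x ^ n) \<longlonglongrightarrow> (\<Sum>n. fps_nth (\<Prod>k<n. f k) n * x ^ n)"
    by (intro conjunct2[OF tannerys_theorem[of "\<lambda>n N. fps_nth (\<Prod>k<N. f k) n * x ^ n" _ sequentially M]])
      (auto intro: always_eventually)
  then show "summable (\<lambda>n. norm (fps_nth (\<Prod>k<n. f k) n * x ^ n))"
    by simp
  show "(\<lambda>N. \<Prod>k<N. \<Sum>n. fps_nth (f k) n * x ^ n) \<longlonglongrightarrow> (\<Sum>n. fps_nth (\<Prod>k<n. f k) n * x ^ n)"
    using * fps_prod_eval[of f x, OF summ] by simp
qed

section \<open>Partitions as coefficients of a finite product\<close>

text \<open>The bound \<open>N\<close> on the parts is separated from the size \<open>n\<close>,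
  which allows an induction on the number of factors; \<open>N = n\<close> gives back
  \<open>partitions n\<close>.\<close>

definition bounded_partitions :: "nat \<Rightarrow> nat \<Rightarrow> (nat \<Rightarrow> nat) set" where
  "bounded_partitions N n = {r. (\<forall>i. r i \<noteq> 0 \<longrightarrow> 1 \<le> i \<and> i \<le> N) \<and> (\<Sum>i=1..N. i * r i) = n}"

lemma finite_bounded_partitions: "finite (bounded_partitions N n)"
proof (rule finite_subset)
  show "bounded_partitions N n \<subseteq>
      {r. \<forall>i. (i \<in> {1..N} \<longrightarrow> r i \<in> {..n}) \<and> (i \<notin> {1..N} \<longrightarrow> r i = 0)}"
  proof (safe)
    fix r i
    assume r: "r \<in> bounded_partitions N n" 
    {
      assume i: "i \<in> {1..N}"
      have "r i \<le> i * r i"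
        using i by (cases i) auto
      also have "i * r i \<le> (\<Sum>i=1..N. i * r i)"
        using i by (intro member_le_sum) auto
      finally show "r i \<le> n"
        using r by (simp add: bounded_partitions_def)
    }
    assume "i \<notin> {1..N}"
    then show "r i = 0"
      using r by (auto simp: bounded_partitions_def)
  qed
  show "finite {r. \<forall>i. (i \<in> {1..N} \<longrightarrow> r i \<in> {..n}) \<and> (i \<notin> {1..N} \<longrightarrow> r i = (0::nat))}"
    by (rule finite_set_of_finite_funs) auto
qed

lemma bounded_partitions_0: "bounded_partitions 0 n = (if n = 0 then {\<lambda>_. 0} else {})"
  by (auto simp: bounded_partitions_def fun_eq_iff)

text \<open>Choosing the term of index \<open>r i\<close> in factor \<open>i\<close> contributes
  \<open>c i (r i)\<close> in degree \<open>i * r i\<close>, so degree \<open>n\<close> collects the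
  choices of total size \<open>n\<close>. The induction splits off the multiplicity of the largest
  admissible part. As \<open>c\<close> is arbitrary, this serves both for \<open>P\<close> and for
  the weighted sums \<open>F\<close>.\<close>

lemma prod_compose_X_power_nth:
  fixes c :: "nat \<Rightarrow> nat \<Rightarrow> 'a::idom"
  shows "fps_nth (\<Prod>i=1..N. Abs_fps (c i) oo fps_X ^ i) n =
    (\<Sum>r\<in>bounded_partitions N n. \<Prod>i=1..N. c i (r i))"
proof (induction N arbitrary: n)
  case 0
  show ?case
    by (simp add: bounded_partitions_0)
next
  case (Suc N)
  let ?J = "{j \<in> {0..n}. Suc N dvd n - j}"
  have "fps_nth (\<Prod>i=1..Suc N. Abs_fps (c i) oo fps_X ^ i) n =
      (\<Sum>j\<in>{0..n}. (\<Sum>r\<in>bounded_partitions N j. \<Prod>i=1..N. c i (r i)) *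
        (if Suc N dvd n - j then c (Suc N) ((n - j) div Suc N) else 0))"
    by (simp add: fps_mult_nth fps_nth_compose_X_power Suc[simplified] del: power_Suc cong: if_cong)
  also have "\<dots> = (\<Sum>j\<in>?J. \<Sum>r\<in>bounded_partitions N j.
      (\<Prod>i=1..N. c i (r i)) * c (Suc N) ((n - j) div Suc N))"
    by (simp add: sum.If_cases if_distrib sum_distrib_right Int_def sum.inter_filter cong: if_cong)
  also have "\<dots> = (\<Sum>(j, r)\<in>(SIGMA j:?J. bounded_partitions N j).
      (\<Prod>i=1..N. c i (r i)) * c (Suc N) ((n - j) div Suc N))"
    by (rule sum.Sigma) (auto intro: finite_bounded_partitions)
  \<comment> \<open>Here \<open>j\<close> is the size left after deleting all parts equal to
    \<open>Suc N\<close>, whose number is therefore \<open>(n - j) div Suc N\<close>. Resetting this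
    multiplicity to 0 inverts the insertion, since \<open>r\<close> vanishes at \<open>Suc N\<close>
    beforehand.\<close>
  also have "\<dots> = (\<Sum>r\<in>bounded_partitions (Suc N) n. \<Prod>i=1..Suc N. c i (r i))"
  proof (rule sum.reindex_bij_witness[where
        i = "\<lambda>r. (n - Suc N * r (Suc N), r(Suc N := 0))" and
        j = "\<lambda>(j, r). r(Suc N := (n - j) div Suc N)"], goal_cases)
    case (1 x)
    then obtain j r where x: "x = (j, r)" "j \<le> n" "Suc N dvd n - j" "r \<in> bounded_partitions N j"
      by auto
    then have "r (Suc N) = 0" "Suc N * ((n - j) div Suc N) = n - j"
      by (fastforce simp: bounded_partitions_def, intro dvd_mult_div_cancel)
    then show ?case
      using x by (auto simp: fun_eq_iff simp del: mult_Suc)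
  next
    case (2 x)
    then obtain j r where x: "x = (j, r)" "j \<le> n" "Suc N dvd n - j" "r \<in> bounded_partitions N j"
      by auto
    let ?r = "r(Suc N := (n - j) div Suc N)"
    have "(\<Sum>i=1..N. i * ?r i) = j"
      using x(4) by (auto simp: bounded_partitions_def intro!: sum.cong)
    moreover have "Suc N * ((n - j) div Suc N) = n - j"
      using x by (intro dvd_mult_div_cancel)
    ultimately have "(\<Sum>i=1..Suc N. i * ?r i) = n"
      using x(2) by (simp del: mult_Suc)
    then have "?r \<in> bounded_partitions (Suc N) n"
      using x(4) by (fastforce simp: bounded_partitions_def le_Suc_eq simp del: mult_Suc)
    then show ?case
      using x by simp
  next
    case (3 r)
    then have "(\<Sum>i=1..N. i * r i) + Suc N * r (Suc N) = n"
      by (simp add: bounded_partitions_def)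
    then show ?case
      by (auto simp del: mult_Suc)
  next
    case (4 r)
    then have *: "(\<Sum>i=1..N. i * r i) + Suc N * r (Suc N) = n"
      by (simp add: bounded_partitions_def)
    have "(\<Sum>i=1..N. i * (r(Suc N := 0)) i) = (\<Sum>i=1..N. i * r i)"
      by (rule sum.cong) auto
    also have "\<dots> = n - Suc N * r (Suc N)"
      using * by simp
    finally have "r(Suc N := 0) \<in> bounded_partitions N (n - Suc N * r (Suc N))"
      using 4 by (force simp: bounded_partitions_def le_Suc_eq simp del: mult_Suc)
    moreover have "n - (n - Suc N * r (Suc N)) = Suc N * r (Suc N)"
      using * by simp
    ultimately show ?case
      by (simp del: mult_Suc)
  next
    case (5 x)
    then obtain j r where x: "x = (j, r)"
      by (cases x)
    have "(\<Prod>i=1..N. c i (r i)) = (\<Prod>i=1..N. c i ((r(Suc N := (n - j) div Suc N)) i))"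
      by (rule prod.cong) auto
    then show ?case
      by (simp add: x)
  qed
  finally show ?case .
qed

section \<open>The factors of the generating function and its coefficients\<close>

lemma inverse_fps_binomial: "inverse (fps_binomial c) = fps_binomial (- c :: 'a::field_char_0)"
  using fps_binomial_add_mult[of c "- c"] by (intro fps_inverse_unique) simp

text \<open>The sign of the binomial coefficient with negated upper argument cancels that of
  \<open>(- x) ^ m\<close>. This turns the binomial series of (1 - x)^(-c) into its rising factorial
  form.\<close>

lemma gbinomial_uminus_mult_power:
  "(- c gchoose m) * (- x) ^ m = pochhammer c m / fact m * (x :: 'a::field_char_0) ^ m"
proof -
  have "(- 1) ^ m * (- x) ^ m = x ^ m"
    by (simp flip: power_mult_distrib)
  then show ?thesis
    by (simp add: gbinomial_pochhammer mult_ac)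
qed

lemma Q_factor_eq:
  assumes "k \<ge> 1"
  shows "Q_factor b z k = Abs_fps (\<lambda>m. pochhammer (b k) m / fact m * z ^ m) oo fps_X ^ k"
proof -
  \<comment> \<open>The substituted series is split into a scaling by \<open>- z\<close> followed by
    X -> X^k. Since \<open>k \<ge> 1\<close>, the inner series has constant coefficient 0, as the
    composition laws require.\<close>
  have *: "- (fps_const z * fps_X ^ k) = (fps_const (- z) * fps_X) oo (fps_X ^ k :: complex fps)"
    using assms by (simp add: fps_compose_mult_distrib fps_compose_uminus flip: fps_const_neg)
  have "Q_factor b z k = fps_binomial (- b k) oo (- (fps_const z * fps_X ^ k))"
    unfolding Q_factor_def using assms
    by (subst fps_inverse_compose[symmetric]) (auto simp: inverse_fps_binomial)
  also have "\<dots> = fps_binomial (- b k) oo (fps_const (- z) * fps_X) oo fps_X ^ k"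
    unfolding * using assms by (intro fps_compose_assoc) auto
  also have "fps_binomial (- b k) oo (fps_const (- z) * fps_X) =
      Abs_fps (\<lambda>m. pochhammer (b k) m / fact m * z ^ m)"
    unfolding fps_compose_linear
    by (simp add: fps_eq_iff gbinomial_uminus_mult_power mult.commute[of "(- z) ^ _"])
  finally show ?thesis .
qed

lemma Q_factor_nth:
  assumes "k \<ge> 1"
  shows "fps_nth (Q_factor b z k) n =
    (if k dvd n then pochhammer (b k) (n div k) / fact (n div k) * z ^ (n div k) else 0)"
  using assms by (simp add: Q_factor_eq fps_nth_compose_X_power)

lemma Q_factor_nth_0: "k \<ge> 1 \<Longrightarrow> fps_nth (Q_factor b z k) 0 = 1"
  by (simp add: Q_factor_nth)

lemma Q_factor_nth_eq_0: "0 < j \<Longrightarrow> j < k \<Longrightarrow> fps_nth (Q_factor b z k) j = 0"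
  by (auto simp: Q_factor_nth dest: dvd_imp_le)

lemma has_prod_Q_factor:
  "(\<lambda>k. Q_factor b z (Suc k)) has_prod Abs_fps (\<lambda>n. fps_nth (\<Prod>k<n. Q_factor b z (Suc k)) n)"
  by (rule fps_has_prod) (auto simp: Q_factor_nth_0 Q_factor_nth_eq_0)

lemma P_eq: "P b z n = fps_nth (\<Prod>k<n. Q_factor b z (Suc k)) n"
  unfolding P_def Q_def has_prod_unique[OF has_prod_Q_factor, symmetric] by simp

text \<open>Any sufficiently long product will do, so the values \<open>P b z (n - j)\<close> for
  all \<open>j\<close> can be read off one and the same product.\<close>

lemma P_eq_nth_prod:
  assumes "n \<le> N"
  shows "P b z n = fps_nth (\<Prod>i=1..N. Q_factor b z i) n"
  unfolding P_eq One_nat_def prod.atLeast1_atMost_eq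
  by (rule fps_prod_nth_stable[symmetric]) (use assms in \<open>auto simp: Q_factor_nth_0 Q_factor_nth_eq_0\<close>)

lemma partitions_eq: "partitions n = bounded_partitions n n"
  by (simp add: partitions_def bounded_partitions_def)

lemma P_eq_sum_weight: "P b z n = (\<Sum>r\<in>partitions n. weight b z n r)"
proof -
  have "P b z n = fps_nth (\<Prod>i=1..n. Abs_fps (\<lambda>m. pochhammer (b i) m / fact m * z ^ m) oo fps_X ^ i) n"
    unfolding P_eq_nth_prod[OF order_refl] by (simp add: Q_factor_eq)
  then show ?thesis
    unfolding prod_compose_X_power_nth by (simp add: partitions_eq weight_def)
qed

section \<open>The recurrence and the weighted sum\<close>

text \<open>Coefficient form of x d/dx (1 - x)^(-c) = c x/(1 - x) * (1 - x)^(-c). The induction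
  rests on (m+1) (c)_(m+1)/(m+1)! = (c + m) (c)_m/m!.\<close>

lemma of_nat_mult_pochhammer_fact:
  fixes c :: "'a::field_char_0"
  shows "of_nat m * (pochhammer c m / fact m) = (\<Sum>i<m. c * (pochhammer c i / fact i))"
proof (induction m)
  case (Suc m)
  have "of_nat (Suc m) * (pochhammer c (Suc m) / fact (Suc m)) = (c + of_nat m) * (pochhammer c m / fact m)"
    by (simp add: pochhammer_Suc mult_ac del: of_nat_Suc)
  also have "\<dots> = c * (pochhammer c m / fact m) + of_nat m * (pochhammer c m / fact m)"
    by (rule distrib_right)
  finally show ?case
    unfolding Suc by simp
qed simp

lemma fps_of_nat_mult_pochhammer:
  fixes c z :: "'a::field_char_0"
  shows "Abs_fps (\<lambda>m. of_nat m * (pochhammer c m / fact m * z ^ m)) =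
    Abs_fps (\<lambda>m. if m = 0 then 0 else c * z ^ m) * Abs_fps (\<lambda>m. pochhammer c m / fact m * z ^ m)"
proof (rule fps_ext)
  fix n
  have "fps_nth (Abs_fps (\<lambda>m. pochhammer c m / fact m * z ^ m) * Abs_fps (\<lambda>m. if m = 0 then 0 else c * z ^ m)) n =
     (\<Sum>i\<in>{0..n}. if i < n then c * (pochhammer c i / fact i) * z ^ n else 0)"
    unfolding fps_mult_nth
  proof (rule sum.cong)
    fix i assume i: "i \<in> {0..n}"
    then have z: "z ^ n = z ^ i * z ^ (n - i)"
      by (simp flip: power_add)
    then show "fps_nth (Abs_fps (\<lambda>m. pochhammer c m / fact m * z ^ m)) i *
        fps_nth (Abs_fps (\<lambda>m. if m = 0 then 0 else c * z ^ m)) (n - i) =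
        (if i < n then c * (pochhammer c i / fact i) * z ^ n else 0)"
    proof (cases "i < n")
      case True
      then show ?thesis
        unfolding z by simp
    qed (use i in simp)
  qed simp
  also have "\<dots> = (\<Sum>i<n. c * (pochhammer c i / fact i) * z ^ n)"
    by (intro sum.mono_neutral_cong_right) auto
  also have "\<dots> = of_nat n * (pochhammer c n / fact n * z ^ n)"
    unfolding sum_distrib_right[symmetric] of_nat_mult_pochhammer_fact[symmetric] by (rule mult.assoc)
  finally show "fps_nth (Abs_fps (\<lambda>m. of_nat m * (pochhammer c m / fact m * z ^ m))) n =
      fps_nth (Abs_fps (\<lambda>m. if m = 0 then 0 else c * z ^ m) *
        Abs_fps (\<lambda>m. pochhammer c m / fact m * z ^ m)) n"
    by (simp add: mult.commute)
qed

text \<open>The numbers \<open>a b z i j\<close> are the coefficients of b_i x/(1 - x) at x = z X^i;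
  the vanishing constant term encodes \<open>r \<ge> 1\<close>.\<close>

lemma a_eq:
  assumes "i \<ge> 1"
  shows "a b z i j = fps_nth (Abs_fps (\<lambda>m. if m = 0 then 0 else b i * z ^ m) oo fps_X ^ i) j"
proof -
  have "(\<exists>r\<ge>1. j = r * i) \<longleftrightarrow> i dvd j \<and> j div i \<noteq> 0"
    using assms by (auto simp: dvd_def mult.commute Suc_le_eq)
  then show ?thesis
    by (auto simp: a_def fps_nth_compose_X_power)
qed

lemma F_eq_sum_partitions: "F b z k n = (\<Sum>r\<in>partitions n. of_nat (r k) * weight b z n r)"
  unfolding F_def by (rule sum.mono_neutral_left) (auto simp: finite_partitions)

lemma F_recurrence:
  assumes k: "k \<in> {1..n}"
  shows "F b z k n = (\<Sum>j=1..n. a b z k j * P b z (n - j))"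
proof -
  define g where "g i m = pochhammer (b i) m / fact m * z ^ m" for i m
  define L where "L = Abs_fps (\<lambda>m. if m = 0 then 0 else b k * z ^ m) oo fps_X ^ k"
  \<comment> \<open>The multiplicity \<open>r k\<close> is absorbed into the factor of index
    \<open>k\<close>, so that the sum again has the shape of a coefficient of a product.\<close>
  have "of_nat (r k) * weight b z n r = (\<Prod>i=1..n. (if i = k then of_nat (r i) else 1) * g i (r i))" for r
    unfolding weight_def g_def prod.distrib using k by (simp add: prod.delta)
  then have "F b z k n = fps_nth
      (\<Prod>i=1..n. Abs_fps (\<lambda>m. (if i = k then of_nat m else 1) * g i m) oo fps_X ^ i) n"
    unfolding prod_compose_X_power_nth by (simp add: F_eq_sum_partitions partitions_eq)
  also have "(\<Prod>i=1..n. Abs_fps (\<lambda>m. (if i = k then of_nat m else 1) * g i m) oo fps_X ^ i) =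
      (\<Prod>i=1..n. (if i = k then L else 1) * Q_factor b z i)"
  proof (rule prod.cong)
    fix i assume i: "i \<in> {1..n}"
    show "Abs_fps (\<lambda>m. (if i = k then of_nat m else 1) * g i m) oo fps_X ^ i =
        (if i = k then L else 1) * Q_factor b z i"
    proof (cases "i = k")
      case True
      have "L * Q_factor b z k = (Abs_fps (\<lambda>m. if m = 0 then 0 else b k * z ^ m) *
          Abs_fps (\<lambda>m. pochhammer (b k) m / fact m * z ^ m)) oo fps_X ^ k"
        using k by (simp add: Q_factor_eq L_def fps_compose_mult_distrib)
      then show ?thesis
        using True unfolding fps_of_nat_mult_pochhammer[symmetric] by (simp add: g_def)
    qed (use i in \<open>simp add: Q_factor_eq g_def\<close>)
  qed simp
  also have "\<dots> = L * (\<Prod>i=1..n. Q_factor b z i)"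
    using k by (simp add: prod.distrib prod.delta)
  also have "fps_nth \<dots> n = (\<Sum>j=0..n. a b z k j * P b z (n - j))"
    using k by (auto simp: fps_mult_nth a_eq L_def P_eq_nth_prod[of _ n] intro!: sum.cong)
  \<comment> \<open>The term \<open>j = 0\<close> drops out because
    \<open>a b z k 0 = 0\<close>.\<close>
  also have "\<dots> = (\<Sum>j=1..n. a b z k j * P b z (n - j))"
    using k by (intro sum.mono_neutral_right) (auto simp: a_def Suc_le_eq)
  finally show ?thesis .
qed

lemma sum_mult_F: "(\<Sum>k=1..n. of_nat k * F b z k n) = of_nat n * P b z n"
proof -
  have "(\<Sum>k=1..n. of_nat k * F b z k n) =
      (\<Sum>r\<in>partitions n. \<Sum>k=1..n. of_nat (k * r k) * weight b z n r)"
    unfolding F_eq_sum_partitions sum_distrib_left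
    by (subst sum.swap) (simp add: mult.assoc)
  also have "\<dots> = (\<Sum>r\<in>partitions n. of_nat (\<Sum>k=1..n. k * r k) * weight b z n r)"
    by (simp add: sum_distrib_right)
  also have "\<dots> = (\<Sum>r\<in>partitions n. of_nat n * weight b z n r)"
    by (rule sum.cong) (auto simp: partitions_def)
  finally show ?thesis
    by (simp add: P_eq_sum_weight sum_distrib_left)
qed

section \<open>Analytic convergence of the product\<close>

lemma norm_pochhammer_le:
  fixes c :: "'a::real_normed_field"
  shows "norm (pochhammer c m) \<le> pochhammer (norm c) m"
proof (induction m)
  case (Suc m)
  have "norm (c + of_nat m) \<le> norm c + real m"
    by (metis norm_triangle_ineq norm_of_nat)
  moreover have "0 \<le> pochhammer (norm c) m"
    using Suc norm_ge_zero order_trans by blast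
  ultimately show ?case
    unfolding pochhammer_Suc norm_mult using Suc by (intro mult_mono) auto
qed simp

text \<open>The coefficients live on multiples of \<open>k\<close>, and reindexing gives the
  binomial series in w = z q^k. With absolute values it is majorised by the binomial series of (1 -
  |w|)^(-|b_k|). The exponential form of the bound turns bounds on products into bounds on
  sums.\<close>

lemma Q_factor_eval:
  assumes k: "k \<ge> 1" and w: "norm (z * q ^ k) < 1"
  shows "summable (\<lambda>n. norm (fps_nth (Q_factor b z k) n * q ^ n))"
    and "(\<Sum>n. norm (fps_nth (Q_factor b z k) n * q ^ n)) \<le>
      exp (norm (b k * (z * q ^ k)) / (1 - norm (z * q ^ k)))"
    and "(\<Sum>n. fps_nth (Q_factor b z k) n * q ^ n) = 1 / (1 - z * q ^ k) powr b k"
proof -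
  let ?w = "z * q ^ k" and ?f = "\<lambda>n. fps_nth (Q_factor b z k) n * q ^ n"
  have mono: "strict_mono (\<lambda>m. k * m)"
    using k by (simp add: strict_mono_def)
  have zero: "?f n = 0" if "n \<notin> range (\<lambda>m. k * m)" for n
    using that k by (auto simp: Q_factor_nth dvd_def)
  have coeff: "?f (k * m) = pochhammer (b k) m / fact m * ?w ^ m" for m
    using k by (simp add: Q_factor_nth power_mult power_mult_distrib)
  have "(\<lambda>m. pochhammer (b k) m / fact m * ?w ^ m) sums (1 - ?w) powr (- b k)"
    using gen_binomial_complex[of "- ?w" "- b k"] w by (simp add: gbinomial_uminus_mult_power)
  then have "?f sums (1 - ?w) powr (- b k)"
    using sums_mono_reindex[OF mono, of ?f] zero by (simp add: coeff)
  then show "(\<Sum>n. ?f n) = 1 / (1 - ?w) powr b k"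
    by (simp add: sums_iff powr_minus_divide)

  let ?g = "\<lambda>m. pochhammer (norm (b k)) m / fact m * norm ?w ^ m"
  have g: "?g sums (1 - norm ?w) powr (- norm (b k))"
    using gen_binomial_real[of "- norm ?w" "- norm (b k)"] w by (simp add: gbinomial_uminus_mult_power)
  have le: "norm (?f (k * m)) \<le> ?g m" for m
    unfolding coeff
    by (simp add: norm_mult norm_divide norm_power divide_right_mono mult_right_mono norm_pochhammer_le)
  have summ: "summable (\<lambda>m. norm (?f (k * m)))"
    by (rule summable_comparison_test'[where N = 0, OF sums_summable[OF g]]) (use le in simp)
  then show "summable (\<lambda>n. norm (?f n))"
    using summable_mono_reindex[OF mono, of "\<lambda>n. norm (?f n)"] zero by simp
  have "(\<Sum>n. norm (?f n)) = (\<Sum>m. norm (?f (k * m)))"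
    using suminf_mono_reindex[OF mono, of "\<lambda>n. norm (?f n)"] zero by simp
  also have "\<dots> \<le> (1 - norm ?w) powr (- norm (b k))"
    using suminf_le[OF le summ sums_summable[OF g]] g by (simp add: sums_iff)
  also have "\<dots> = exp (norm (b k) * ln (inverse (1 - norm ?w)))"
    using w by (simp add: powr_def ln_inverse)
  \<comment> \<open>This is ln x \<le> x - 1 at x = 1/(1 - |w|), where x - 1 = |w|/(1 -
    |w|).\<close>
  also have "\<dots> \<le> exp (norm (b k) * (inverse (1 - norm ?w) - 1))"
    using w by (intro iffD2[OF exp_le_cancel_iff] mult_left_mono ln_le_minus_one) auto
  also have "norm (b k) * (inverse (1 - norm ?w) - 1) = norm (b k * ?w) / (1 - norm ?w)"
    using w by (simp add: norm_mult field_simps)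
  finally show "(\<Sum>n. norm (?f n)) \<le> exp (norm (b k * ?w) / (1 - norm ?w))" .
qed

text \<open>The linear approximation of \<open>Ln\<close> has error at most |w|^2/(1 - |w|); adding
  |w| gives exactly the stated bound. It makes the series of logarithms of the factors
  converge.\<close>

lemma norm_Ln_one_minus_le:
  assumes "norm w < 1"
  shows "norm (Ln (1 - w)) \<le> norm w / (1 - norm w)"
proof -
  have "norm (Ln (1 - w)) \<le> norm (Ln (1 + - w) - - w) + norm (- w)"
    using norm_triangle_ineq[of "Ln (1 + - w) - - w" "- w"] by simp
  also have "\<dots> \<le> norm (- w) ^ 2 / (1 - norm (- w)) + norm (- w)"
    using Ln_approx_linear[of "- w"] assms by simp
  also have "\<dots> = norm w / (1 - norm w)"
    using assms by (simp add: field_simps power2_eq_square)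
  finally show ?thesis .
qed

lemma Q_eval:
  assumes z: "norm z < 1" and q: "norm q < 1"
    and summ: "summable (\<lambda>k. norm (b (Suc k) * (z * q ^ Suc k)))"
  shows "summable (\<lambda>n. norm (P b z n * q ^ n))"
    and "(\<lambda>k. 1 / (1 - z * q ^ Suc k) powr b (Suc k)) has_prod (\<Sum>n. P b z n * q ^ n)"
proof -
  let ?w = "\<lambda>k. z * q ^ Suc k" and ?f = "\<lambda>k. 1 / (1 - z * q ^ Suc k) powr b (Suc k)"
  have w_le: "norm (?w k) \<le> norm z" for k
  proof -
    have "norm (?w k) = norm z * norm q ^ Suc k"
      by (simp add: norm_mult norm_power)
    also have "\<dots> \<le> norm z * 1"
      using q by (intro mult_left_mono power_le_one) auto
    finally show ?thesis
      by simp
  qed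
  then have w: "norm (?w k) < 1" for k
    using z le_less_trans by blast
  \<comment> \<open>By |z q^k| \<le> |z|, the denominator 1 - |z| is uniform in \<open>k\<close>, so
    \<open>B\<close> inherits its summability directly from the hypothesis.\<close>
  define B where "B k = norm (b (Suc k) * ?w k) / (1 - norm z)" for k
  have B: "summable B" "B k \<ge> 0" "norm (b (Suc k) * ?w k) / (1 - norm (?w k)) \<le> B k" for k
    unfolding B_def using summ z w[of k] w_le[of k]
    by (auto intro: summable_divide divide_left_mono)
  have bound: "(\<Prod>k<N. \<Sum>n. norm (fps_nth (Q_factor b z (Suc k)) n * q ^ n)) \<le> exp (suminf B)" for N
  proof -
    have "(\<Sum>n. norm (fps_nth (Q_factor b z (Suc k)) n * q ^ n)) \<le> exp (B k)" for k
    proof -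
      have "(\<Sum>n. norm (fps_nth (Q_factor b z (Suc k)) n * q ^ n)) \<le>
          exp (norm (b (Suc k) * ?w k) / (1 - norm (?w k)))"
        using w by (intro Q_factor_eval) auto
      also have "\<dots> \<le> exp (B k)"
        using B(3) by simp
      finally show ?thesis .
    qed
    then have "(\<Prod>k<N. \<Sum>n. norm (fps_nth (Q_factor b z (Suc k)) n * q ^ n)) \<le> (\<Prod>k<N. exp (B k))"
      using w by (intro prod_mono) (auto intro!: suminf_nonneg Q_factor_eval)
    also have "\<dots> = exp (\<Sum>k<N. B k)"
      by (simp add: exp_sum)
    also have "\<dots> \<le> exp (suminf B)"
      using B by (simp add: sum_le_suminf)
    finally show ?thesis .
  qed
  have summ_Q: "summable (\<lambda>n. norm (fps_nth (Q_factor b z (Suc k)) n * q ^ n))" for k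
    using w by (intro Q_factor_eval) auto
  note eval = fps_infinite_prod_eval[of "\<lambda>k. Q_factor b z (Suc k)", OF _ _ summ_Q bound, folded P_eq]
  show "summable (\<lambda>n. norm (P b z n * q ^ n))"
    by (rule eval) (auto simp: Q_factor_nth_0 Q_factor_nth_eq_0)
  have f_eq: "(\<Sum>n. fps_nth (Q_factor b z (Suc k)) n * q ^ n) = ?f k" for k
    using w by (intro Q_factor_eval) auto
  have "(\<lambda>N. \<Prod>k<N. \<Sum>n. fps_nth (Q_factor b z (Suc k)) n * q ^ n) \<longlonglongrightarrow> (\<Sum>n. P b z n * q ^ n)"
    by (rule eval) (auto simp: Q_factor_nth_0 Q_factor_nth_eq_0)
  then have lim: "(\<lambda>N. \<Prod>k<N. ?f k) \<longlonglongrightarrow> (\<Sum>n. P b z n * q ^ n)"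
    unfolding f_eq .
  \<comment> \<open>\<open>has_prod\<close> requires a nonzero limit. The factors are exponentials
    of the terms of a convergent series, so the limit is itself an exponential.\<close>
  define l where "l k = - (b (Suc k) * Ln (1 - ?w k))" for k
  have f_exp: "?f k = exp (l k)" for k
    using w[of k] by (auto simp: powr_def l_def exp_minus field_simps)
  have "norm (l k) \<le> B k" for k
  proof -
    have "norm (l k) \<le> norm (b (Suc k)) * (norm (?w k) / (1 - norm (?w k)))"
      unfolding l_def norm_minus_cancel norm_mult[of "b (Suc k)"]
      using w by (intro mult_left_mono norm_Ln_one_minus_le) auto
    also have "\<dots> \<le> B k"
      using B(3)[of k] by (simp add: norm_mult)
    finally show ?thesis .
  qed
  then have "summable l"
    by (rule summable_comparison_test'[OF B(1)])
  then have "(\<lambda>N. exp (\<Sum>k<N. l k)) \<longlonglongrightarrow> exp (suminf l)"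
    by (intro tendsto_exp summable_LIMSEQ)
  then have "(\<lambda>N. \<Prod>k<N. ?f k) \<longlonglongrightarrow> exp (suminf l)"
    unfolding f_exp by (simp add: exp_sum)
  then have "(\<Sum>n. P b z n * q ^ n) \<noteq> 0"
    using LIMSEQ_unique[OF lim] by force
  then show "?f has_prod (\<Sum>n. P b z n * q ^ n)"
    \<comment> \<open>\<open>raw_has_prod\<close> speaks of products over \<open>i \<le> n\<close>,
      hence the shift by one.\<close>
    using lim LIMSEQ_Suc[OF lim] by (simp add: has_prod_def raw_has_prod_def lessThan_Suc_atMost)
qed

theorem theorem2p3:
  fixes b :: "nat \<Rightarrow> complex" and z q :: complex
  assumes "norm z < 1" and "norm q < 1"
  shows
    "(\<lambda>k. Q_factor b z (Suc k)) has_prod Abs_fps (P b z) \<and>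
     (summable (\<lambda>k. norm (b (Suc k) * (z * q ^ Suc k))) \<longrightarrow>
        summable (\<lambda>n. norm (P b z n * q ^ n)) \<and>
        (\<lambda>k. 1 / (1 - z * q ^ Suc k) powr b (Suc k)) has_prod (\<Sum>n. P b z n * q ^ n)) \<and>
     (\<forall>n. P b z n = (\<Sum>r \<in> partitions n. weight b z n r)) \<and>
     P b z 0 = 1 \<and>
     (\<forall>n\<ge>1. \<forall>i\<in>{1..n}.
        F b z i n = (\<Sum>j=1..n. a b z i j * P b z (n - j)) \<and>
        of_nat i * F b z i n = (\<Sum>j=1..n. of_nat i * a b z i j * P b z (n - j))) \<and>
     (\<forall>n\<ge>1. (\<Sum>k=1..n. of_nat k * F b z k n) = of_nat n * P b z n)"
proof (intro conjI allI ballI impI)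
  show "(\<lambda>k. Q_factor b z (Suc k)) has_prod Abs_fps (P b z)"
    using has_prod_Q_factor[of b z] by (simp flip: P_eq)
  show "P b z 0 = 1"
    by (simp add: P_eq)
  show "of_nat i * F b z i n = (\<Sum>j=1..n. of_nat i * a b z i j * P b z (n - j))"
    if "i \<in> {1..n}" for i n
    unfolding F_recurrence[OF that] by (simp add: sum_distrib_left mult.assoc)
qed (use Q_eval[OF assms] P_eq_sum_weight F_recurrence sum_mult_F in auto)

end
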